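(* Let $(P,\cdot,[-,-],\varepsilon,\alpha,\beta)$ be a BiHom-Poisson color algebra, let $k,l$ be positive integers, and let $\theta:P\to P$ be an injective $(\alpha^k,\beta^l)$-averaging operator. Then the new products $$x\ast y=\theta(x)\cdot\alpha^k\beta^l(y)\quad\text{and}\quad\{x,y\}=[\theta(x),\alpha^k\beta^l(y)],\qquad x,y\in P,$$ make $(P,\ast,\{-,-\},\varepsilon,\alpha,\beta)$ a BiHom-Poisson color algebra. Moreover, $\theta$ is a morphism of BiHom-Poisson color algebras from $(P,\ast,\{-,-\},\varepsilon,\alpha,\beta)$ to $(P,\cdot,[-,-],\varepsilon,\alpha,\beta)$.
   Context: $\mathbb{K}$ is a field of characteristic different from 2 and $G$ is an abelian group (written additively). A skew-symmetric bicharacter on $G$ is a map $\varepsilon:G\times G\to\mathbb{K}^*$ with $\varepsilon(g,g')\varepsilon(g',g)=1$, $\varepsilon(g,g'+g'')=\varepsilon(g,g')\varepsilon(g,g'')$, $\varepsilon(g+g',g'')=\varepsilon(g,g'')\varepsilon(g',g'')$; $\varepsilon$ denotes such a bicharacter. For homogeneous $x,y$ of degrees $g,g'$ one writes $\varepsilon(x,y)=\varepsilon(g,g')$. A linear map is even if it preserves degrees; a bilinear map $\mu$ is even if $\mu(V_g,V_{g'})\subseteq V_{g+g'}$. A BiHom-Poisson color algebra $(P,\cdot,[-,-],\varepsilon,\alpha,\beta)$ is a $G$-graded $\mathbb{K}$-vector space $P$ with an even bilinear product $\cdot$, an even bilinear bracket $[-,-]$, and even linear maps $\alpha,\beta:P\to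 P$ such that $\alpha\beta=\beta\alpha$, $\alpha$ and $\beta$ are multiplicative for both the product and the bracket, and for all homogeneous $x,y,z$: - $\alpha(x)\cdot(y\cdot z)=(x\cdot y)\cdot\beta(z)$; - $[\beta(x),\alpha(y)]=-\varepsilon(x,y)[\beta(y),\alpha(x)]$; - $\oint_{x,y,z}\varepsilon(z,x)[\beta^2(x),[\beta(y),\alpha(z)]]=0$ (cyclic sum over $x,y,z$); - $[\alpha\beta(x),y\cdot z]=[\beta(x),y]\cdot\beta(z)+\varepsilon(x,y)\,\beta(y)\cdot[\alpha(x),z]$. A morphism of BiHom-Poisson color algebras is an even linear map preserving product and bracket and intertwining the structure maps $\alpha$ and $\beta$. An $(\alpha^k,\beta^l)$-averaging operator is an even linear map $\theta:P\to P$ with $\alpha\theta=\theta\alpha$, $\beta\theta=\theta\beta$, $\theta(\theta(x)\cdot\alpha^k\beta^l(y))=\theta(x)\cdot\theta(y)=\theta(\alpha^k\beta^l(x)\cdot\theta(y))$ and $\theta([\theta(x),\alpha^k\beta^l(y)])=[\theta(x),\theta(y)]=\theta([\alpha^k\beta^l(x),\theta(y)])$ for all homogeneous $x,y$. *)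

theory Defs
  imports Complex_Main
begin

locale skew_bicharacter =
  fixes eps :: "'g::ab_group_add \<Rightarrow> 'g \<Rightarrow> 'k::field"
  assumes eps_nonzero: "eps g h \<noteq> 0"
    and eps_skew: "eps g h * eps h g = 1"
    and eps_add_right: "eps g (h + h') = eps g h * eps g h'"
    and eps_add_left: "eps (g + g') h = eps g h * eps g' h"

text \<open>The vector space is a whole type, and \<open>V g\<close> is its homogeneous component of
  degree \<open>g\<close>. The last assumption says that the space is the internal direct sum of the \<open>V g\<close>:
  every vector has exactly one decomposition into finitely many homogeneous components.\<close>

locale graded_vector_space = vector_space scale
  for scale :: "'k::field \<Rightarrow> 'p::ab_group_add \<Rightarrow> 'p" +
  fixes V :: "'g::ab_group_add \<Rightarrow> 'p set"
  assumes component_subspace: "subspace (V g)"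
    and direct_sum: "\<exists>!c. (\<forall>g. c g \<in> V g) \<and> finite {g. c g \<noteq> 0} \<and> x = (\<Sum>g | c g \<noteq> 0. c g)"

definition even_map :: "('g \<Rightarrow> 'p set) \<Rightarrow> ('g \<Rightarrow> 'q set) \<Rightarrow> ('p \<Rightarrow> 'q) \<Rightarrow> bool"
  where "even_map V W f \<longleftrightarrow> (\<forall>g. f ` V g \<subseteq> W g)"

definition even_bilinear_map ::
    "('k::field \<Rightarrow> 'p::ab_group_add \<Rightarrow> 'p) \<Rightarrow> ('g::ab_group_add \<Rightarrow> 'p set) \<Rightarrow> ('p \<Rightarrow> 'p \<Rightarrow> 'p) \<Rightarrow> bool"
  where "even_bilinear_map scale V m \<longleftrightarrow>
    (\<forall>x. Vector_Spaces.linear scale scale (\<lambda>y. m x y)) \<and>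
    (\<forall>y. Vector_Spaces.linear scale scale (\<lambda>x. m x y)) \<and>
    (\<forall>g h. \<forall>x\<in>V g. \<forall>y\<in>V h. m x y \<in> V (g + h))"

text \<open>An identity for homogeneous elements is quantified over degrees \<open>g\<close>, \<open>h\<close>, \<open>i\<close> and elements
  of the corresponding components. The zero vector lies in every component, but every identity
  below holds trivially as soon as one of its arguments is zero.\<close>

locale bihom_poisson_color_algebra =
  graded_vector_space scale V + skew_bicharacter eps
  for scale :: "'k::field \<Rightarrow> 'p::ab_group_add \<Rightarrow> 'p" (infixr \<open>*s\<close> 75)
    and V :: "'g::ab_group_add \<Rightarrow> 'p set"
    and prd :: "'p \<Rightarrow> 'p \<Rightarrow> 'p" (infixl \<open>\<cdot>\<close> 70)
    and brk :: "'p \<Rightarrow> 'p \<Rightarrow> 'p"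
    and eps :: "'g \<Rightarrow> 'g \<Rightarrow> 'k"
    and \<alpha> :: "'p \<Rightarrow> 'p"
    and \<beta> :: "'p \<Rightarrow> 'p" +
  assumes prd_even_bilinear: "even_bilinear_map scale V prd"
    and brk_even_bilinear: "even_bilinear_map scale V brk"
    and alpha_linear: "Vector_Spaces.linear scale scale \<alpha>"
    and alpha_even: "even_map V V \<alpha>"
    and beta_linear: "Vector_Spaces.linear scale scale \<beta>"
    and beta_even: "even_map V V \<beta>"
    and alpha_beta_commute: "\<alpha> (\<beta> x) = \<beta> (\<alpha> x)"
    and alpha_prd: "\<alpha> (x \<cdot> y) = \<alpha> x \<cdot> \<alpha> y"
    and beta_prd: "\<beta> (x \<cdot> y) = \<beta> x \<cdot> \<beta> y"
    and alpha_brk: "\<alpha> (brk x y) = brk (\<alpha> x) (\<alpha> y)"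
    and beta_brk: "\<beta> (brk x y) = brk (\<beta> x) (\<beta> y)"
    and bihom_assoc: "\<lbrakk>x \<in> V g; y \<in> V h; z \<in> V i\<rbrakk> \<Longrightarrow> \<alpha> x \<cdot> (y \<cdot> z) = (x \<cdot> y) \<cdot> \<beta> z"
    and bihom_skew: "\<lbrakk>x \<in> V g; y \<in> V h\<rbrakk> \<Longrightarrow>
      brk (\<beta> x) (\<alpha> y) = - (eps g h *s brk (\<beta> y) (\<alpha> x))"
    and bihom_jacobi: "\<lbrakk>x \<in> V g; y \<in> V h; z \<in> V i\<rbrakk> \<Longrightarrow>
      eps i g *s brk (\<beta> (\<beta> x)) (brk (\<beta> y) (\<alpha> z))
      + eps g h *s brk (\<beta> (\<beta> y)) (brk (\<beta> z) (\<alpha> x))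
      + eps h i *s brk (\<beta> (\<beta> z)) (brk (\<beta> x) (\<alpha> y)) = 0"
    and bihom_leibniz: "\<lbrakk>x \<in> V g; y \<in> V h; z \<in> V i\<rbrakk> \<Longrightarrow>
      brk (\<alpha> (\<beta> x)) (y \<cdot> z) = brk (\<beta> x) y \<cdot> \<beta> z + eps g h *s (\<beta> y \<cdot> brk (\<alpha> x) z)"

locale bihom_poisson_color_morphism =
  A: bihom_poisson_color_algebra scale V prd brk eps \<alpha> \<beta> +
  B: bihom_poisson_color_algebra scale' V' prd' brk' eps \<alpha>' \<beta>'
  for scale :: "'k::field \<Rightarrow> 'p::ab_group_add \<Rightarrow> 'p"
    and V :: "'g::ab_group_add \<Rightarrow> 'p set"
    and prd brk eps \<alpha> \<beta>
    and scale' :: "'k \<Rightarrow> 'q::ab_group_add \<Rightarrow> 'q"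
    and V' :: "'g \<Rightarrow> 'q set"
    and prd' brk' \<alpha>' \<beta>' +
  fixes f :: "'p \<Rightarrow> 'q"
  assumes morphism_linear: "Vector_Spaces.linear scale scale' f"
    and morphism_even: "even_map V V' f"
    and morphism_prd: "f (prd x y) = prd' (f x) (f y)"
    and morphism_brk: "f (brk x y) = brk' (f x) (f y)"
    and morphism_alpha: "f (\<alpha> x) = \<alpha>' (f x)"
    and morphism_beta: "f (\<beta> x) = \<beta>' (f x)"

locale averaging_operator =
  bihom_poisson_color_algebra scale V prd brk eps \<alpha> \<beta>
  for scale :: "'k::field \<Rightarrow> 'p::ab_group_add \<Rightarrow> 'p"
    and V :: "'g::ab_group_add \<Rightarrow> 'p set"
    and prd :: "'p \<Rightarrow> 'p \<Rightarrow> 'p" (infixl \<open>\<cdot>\<close> 70)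
    and brk eps \<alpha> \<beta> +
  fixes k l :: nat
    and \<theta> :: "'p \<Rightarrow> 'p"
  assumes theta_linear: "Vector_Spaces.linear scale scale \<theta>"
    and theta_even: "even_map V V \<theta>"
    and theta_alpha: "\<alpha> (\<theta> x) = \<theta> (\<alpha> x)"
    and theta_beta: "\<beta> (\<theta> x) = \<theta> (\<beta> x)"
    and theta_prd_left: "\<lbrakk>x \<in> V g; y \<in> V h\<rbrakk> \<Longrightarrow>
      \<theta> (\<theta> x \<cdot> (\<alpha> ^^ k) ((\<beta> ^^ l) y)) = \<theta> x \<cdot> \<theta> y"
    and theta_prd_right: "\<lbrakk>x \<in> V g; y \<in> V h\<rbrakk> \<Longrightarrow>
      \<theta> x \<cdot> \<theta> y = \<theta> ((\<alpha> ^^ k) ((\<beta> ^^ l) x) \<cdot> \<theta> y)"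
    and theta_brk_left: "\<lbrakk>x \<in> V g; y \<in> V h\<rbrakk> \<Longrightarrow>
      \<theta> (brk (\<theta> x) ((\<alpha> ^^ k) ((\<beta> ^^ l) y))) = brk (\<theta> x) (\<theta> y)"
    and theta_brk_right: "\<lbrakk>x \<in> V g; y \<in> V h\<rbrakk> \<Longrightarrow>
      brk (\<theta> x) (\<theta> y) = \<theta> (brk ((\<alpha> ^^ k) ((\<beta> ^^ l) x)) (\<theta> y))"

end

theory Submission
  imports Defs
begin

text \<open>The averaging identities say that \<open>\<theta>\<close> carries \<open>x \<ast> y\<close> to \<open>\<theta> x \<cdot> \<theta> y\<close> and \<open>{x, y}\<close> to
  \<open>[\<theta> x, \<theta> y]\<close>, and \<open>\<theta>\<close> commutes with \<open>\<alpha>\<close> and \<open>\<beta>\<close>. Applying \<open>\<theta>\<close> to any identity required of the new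
  products therefore gives the same identity of the original algebra at the arguments \<open>\<theta> x\<close>, \<open>\<theta> y\<close>,
  \<open>\<theta> z\<close>, which have the same degrees as homogeneous \<open>x\<close>, \<open>y\<close>, \<open>z\<close>; as \<open>\<theta>\<close> is injective, the identity holds
  before \<open>\<theta>\<close> is applied. This transfer is \<open>bihom_poisson_color_algebra_pullback\<close>.

  The averaging identities are assumed for homogeneous arguments only, while a morphism must
  preserve the products of all pairs of vectors. The gap is closed by bilinearity, since homogeneous
  vectors span the space (\<open>bilinear_eq_on_homogeneous\<close>).\<close>

lemma (in graded_vector_space) linear_eq_on_homogeneous:
  assumes f: "Vector_Spaces.linear scale scale' f"
    and f': "Vector_Spaces.linear scale scale' f'"
    and agree: "\<And>g x. x \<in> V g \<Longrightarrow> f x = f' x"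
  shows "f x = f' x"
proof -
  interpret f: Vector_Spaces.linear scale scale' f by (fact f)
  interpret f': Vector_Spaces.linear scale scale' f' by (fact f')
  obtain c where c: "\<And>g. c g \<in> V g" and x: "x = (\<Sum>g | c g \<noteq> 0. c g)"
    using direct_sum[of x] by blast
  have "f x = (\<Sum>g | c g \<noteq> 0. f (c g))"
    by (subst x) (rule f.sum)
  also have "\<dots> = (\<Sum>g | c g \<noteq> 0. f' (c g))"
    using agree c by (intro sum.cong refl) blast
  also have "\<dots> = f' x"
    by (subst x) (rule f'.sum[symmetric])
  finally show ?thesis .
qed

lemma (in graded_vector_space) bilinear_eq_on_homogeneous:
  assumes left: "\<And>y. Vector_Spaces.linear scale scale' (\<lambda>x. m x y)"
      "\<And>y. Vector_Spaces.linear scale scale' (\<lambda>x. m' x y)"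
    and right: "\<And>x. Vector_Spaces.linear scale scale' (m x)"
      "\<And>x. Vector_Spaces.linear scale scale' (m' x)"
    and agree: "\<And>g h x y. x \<in> V g \<Longrightarrow> y \<in> V h \<Longrightarrow> m x y = m' x y"
  shows "m x y = m' x y"
proof (rule linear_eq_on_homogeneous[OF left])
  fix g x assume x: "x \<in> V g"
  show "m x y = m' x y"
    by (rule linear_eq_on_homogeneous[OF right agree[OF x]])
qed

lemma linear_funpow:
  assumes "Vector_Spaces.linear scale scale f"
  shows "Vector_Spaces.linear scale scale (f ^^ n)"
proof (induction n)
  case 0
  interpret f: Vector_Spaces.linear scale scale f by (fact assms)
  show ?case using f.vs1.linear_id by (simp add: id_def)
next
  case (Suc n)
  show ?case using Vector_Spaces.linear_compose[OF Suc assms] by (simp only: funpow.simps)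
qed

lemma even_map_comp:
  "even_map V W f \<Longrightarrow> even_map W X f' \<Longrightarrow> even_map V X (f' \<circ> f)"
  by (simp add: even_map_def image_subset_iff)

lemma even_map_funpow: "even_map V V f \<Longrightarrow> even_map V V (f ^^ n)"
  by (induction n) (simp_all add: even_map_def image_subset_iff)

lemma even_bilinear_map_comp:
  assumes m: "even_bilinear_map scale V m"
    and f: "Vector_Spaces.linear scale scale f" "even_map V V f"
    and f': "Vector_Spaces.linear scale scale f'" "even_map V V f'"
  shows "even_bilinear_map scale V (\<lambda>x y. m (f x) (f' y))"
proof -
  have "Vector_Spaces.linear scale scale (\<lambda>y. m (f x) (f' y))" for x
    using Vector_Spaces.linear_compose[OF f'(1), of scale "m (f x)"] m
    by (simp add: even_bilinear_map_def o_def)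
  moreover have "Vector_Spaces.linear scale scale (\<lambda>x. m (f x) (f' y))" for y
    using Vector_Spaces.linear_compose[OF f(1), of scale "\<lambda>x. m x (f' y)"] m
    by (simp add: even_bilinear_map_def o_def)
  ultimately show ?thesis
    using m f(2) f'(2) unfolding even_bilinear_map_def even_map_def by blast
qed

text \<open>Each of the defining identities, from commutation of \<open>\<alpha>\<close> and \<open>\<beta>\<close> to the Leibniz rule, equates
  two expressions built from the operations by linear combinations. An even linear map that
  preserves the operations sends both to the corresponding expressions of the target algebra, with
  the same coefficients \<open>eps\<close> because degrees are kept; if it is injective, equality there gives
  equality here.\<close>

lemma bihom_poisson_color_algebra_pullback:
  assumes algebra: "bihom_poisson_color_algebra scale' V' prd' brk' eps \<alpha>' \<beta>'"
    and graded: "graded_vector_space scale V"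
    and prd: "even_bilinear_map scale V prd" and brk: "even_bilinear_map scale V brk"
    and \<alpha>: "Vector_Spaces.linear scale scale \<alpha>" "even_map V V \<alpha>"
    and \<beta>: "Vector_Spaces.linear scale scale \<beta>" "even_map V V \<beta>"
    and f: "Vector_Spaces.linear scale scale' f" "even_map V V' f" "inj f"
    and f_prd: "\<And>x y. f (prd x y) = prd' (f x) (f y)"
    and f_brk: "\<And>x y. f (brk x y) = brk' (f x) (f y)"
    and f_alpha: "\<And>x. f (\<alpha> x) = \<alpha>' (f x)"
    and f_beta: "\<And>x. f (\<beta> x) = \<beta>' (f x)"
  shows "bihom_poisson_color_algebra scale V prd brk eps \<alpha> \<beta>"
proof -
  interpret B: bihom_poisson_color_algebra scale' V' prd' brk' eps \<alpha>' \<beta>' by (fact algebra)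
  interpret graded_vector_space scale V by (fact graded)
  interpret f: Vector_Spaces.linear scale scale' f by (fact f(1))
  note f_simps = f_prd f_brk f_alpha f_beta f.add f.neg f.scale
  have degree: "f x \<in> V' g" if "x \<in> V g" for x g
    using f(2) that unfolding even_map_def by blast
  show ?thesis
  proof (intro bihom_poisson_color_algebra.intro graded B.skew_bicharacter_axioms
      bihom_poisson_color_algebra_axioms.intro prd brk \<alpha> \<beta>, goal_cases)
    case (1 x)
    show ?case by (rule injD[OF f(3)]) (simp add: f_simps B.alpha_beta_commute)
  next
    case (2 x y)
    show ?case by (rule injD[OF f(3)]) (simp add: f_simps B.alpha_prd)
  next
    case (3 x y)
    show ?case by (rule injD[OF f(3)]) (simp add: f_simps B.beta_prd)
  next
    case (4 x y)
    show ?case by (rule injD[OF f(3)]) (simp add: f_simps B.alpha_brk)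
  next
    case (5 x y)
    show ?case by (rule injD[OF f(3)]) (simp add: f_simps B.beta_brk)
  next
    case (6 x g y h z i)
    show ?case
      using B.bihom_assoc[OF 6[THEN degree]] by - (rule injD[OF f(3)], simp add: f_simps)
  next
    case (7 x g y h)
    show ?case
      using B.bihom_skew[OF 7[THEN degree]] by - (rule injD[OF f(3)], simp add: f_simps)
  next
    case (8 x g y h z i)
    show ?case
      using B.bihom_jacobi[OF 8[THEN degree]] by - (rule injD[OF f(3)], simp add: f_simps)
  next
    case (9 x g y h z i)
    show ?case
      using B.bihom_leibniz[OF 9[THEN degree]] by - (rule injD[OF f(3)], simp add: f_simps)
  qed
qed

text \<open>Applied with \<open>m'\<close> the new product or bracket and \<open>m\<close> the old one: both sides are bilinear in
  \<open>x\<close> and \<open>y\<close>, so homogeneous arguments decide the equation.\<close>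

lemma (in graded_vector_space) preserves_bilinear_map_if_on_homogeneous:
  assumes m: "even_bilinear_map scale V m" and m': "even_bilinear_map scale V m'"
    and \<theta>: "Vector_Spaces.linear scale scale \<theta>"
    and agree: "\<And>g h x y. x \<in> V g \<Longrightarrow> y \<in> V h \<Longrightarrow> \<theta> (m' x y) = m (\<theta> x) (\<theta> y)"
  shows "\<theta> (m' x y) = m (\<theta> x) (\<theta> y)"
proof (rule bilinear_eq_on_homogeneous[where scale' = scale
      and m = "\<lambda>x y. \<theta> (m' x y)" and m' = "\<lambda>x y. m (\<theta> x) (\<theta> y)"])
  note comp = Vector_Spaces.linear_compose[unfolded o_def]
  show "Vector_Spaces.linear scale scale (\<lambda>x. \<theta> (m' x y))" for y
    using m' by (intro comp[OF _ \<theta>]) (simp add: even_bilinear_map_def)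
  show "Vector_Spaces.linear scale scale (\<lambda>y. \<theta> (m' x y))" for x
    using m' by (intro comp[OF _ \<theta>]) (simp add: even_bilinear_map_def)
  show "Vector_Spaces.linear scale scale (\<lambda>x. m (\<theta> x) (\<theta> y))" for y
    using m by (intro comp[OF \<theta>, of scale "\<lambda>x. m x (\<theta> y)"]) (simp add: even_bilinear_map_def)
  show "Vector_Spaces.linear scale scale (\<lambda>y. m (\<theta> x) (\<theta> y))" for x
    using m by (intro comp[OF \<theta>, of scale "m (\<theta> x)"]) (simp add: even_bilinear_map_def)
qed (rule agree, assumption+)

theorem theorem3p21:
  fixes scale :: "'k::field \<Rightarrow> 'p::ab_group_add \<Rightarrow> 'p"
    and V :: "'g::ab_group_add \<Rightarrow> 'p set"
    and prd brk :: "'p \<Rightarrow> 'p \<Rightarrow> 'p"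
    and eps :: "'g \<Rightarrow> 'g \<Rightarrow> 'k"
    and \<alpha> \<beta> \<theta> :: "'p \<Rightarrow> 'p"
    and k l :: nat
  assumes char: "CHAR('k) \<noteq> 2"
    and algebra: "bihom_poisson_color_algebra scale V prd brk eps \<alpha> \<beta>"
    and pos: "k > 0" "l > 0"
    and averaging: "averaging_operator scale V prd brk eps \<alpha> \<beta> k l \<theta>"
    and injective: "inj \<theta>"
  shows "let star = (\<lambda>x y. prd (\<theta> x) ((\<alpha> ^^ k) ((\<beta> ^^ l) y)));
             curly = (\<lambda>x y. brk (\<theta> x) ((\<alpha> ^^ k) ((\<beta> ^^ l) y)))
         in bihom_poisson_color_algebra scale V star curly eps \<alpha> \<beta> \<and>
            bihom_poisson_color_morphism scale V star curly eps \<alpha> \<beta> scale V prd brk \<alpha> \<beta> \<theta>"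
proof -
  interpret averaging_operator scale V prd brk eps \<alpha> \<beta> k l \<theta> by (fact averaging)
  define star where "star = (\<lambda>x y. prd (\<theta> x) ((\<alpha> ^^ k) ((\<beta> ^^ l) y)))"
  define curly where "curly = (\<lambda>x y. brk (\<theta> x) ((\<alpha> ^^ k) ((\<beta> ^^ l) y)))"
  have twist: "Vector_Spaces.linear scale scale ((\<alpha> ^^ k) \<circ> (\<beta> ^^ l))"
      "even_map V V ((\<alpha> ^^ k) \<circ> (\<beta> ^^ l))"
    by (rule Vector_Spaces.linear_compose[OF linear_funpow[OF beta_linear]
          linear_funpow[OF alpha_linear]])
      (rule even_map_comp[OF even_map_funpow[OF beta_even] even_map_funpow[OF alpha_even]])
  have star: "even_bilinear_map scale V star"
    using even_bilinear_map_comp[OF prd_even_bilinear theta_linear theta_even twist]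
    by (simp add: star_def)
  have curly: "even_bilinear_map scale V curly"
    using even_bilinear_map_comp[OF brk_even_bilinear theta_linear theta_even twist]
    by (simp add: curly_def)
  have theta_star: "\<theta> (star x y) = prd (\<theta> x) (\<theta> y)" for x y
    by (rule preserves_bilinear_map_if_on_homogeneous[OF prd_even_bilinear star theta_linear])
      (simp add: star_def theta_prd_left)
  have theta_curly: "\<theta> (curly x y) = brk (\<theta> x) (\<theta> y)" for x y
    by (rule preserves_bilinear_map_if_on_homogeneous[OF brk_even_bilinear curly theta_linear])
      (simp add: curly_def theta_brk_left)
  have new: "bihom_poisson_color_algebra scale V star curly eps \<alpha> \<beta>"
    by (rule bihom_poisson_color_algebra_pullback[OF algebra graded_vector_space_axioms star curly
          alpha_linear alpha_even beta_linear beta_even theta_linear theta_even injective])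
      (simp_all add: theta_star theta_curly theta_alpha theta_beta)
  moreover have
    "bihom_poisson_color_morphism scale V star curly eps \<alpha> \<beta> scale V prd brk \<alpha> \<beta> \<theta>"
    by (intro bihom_poisson_color_morphism.intro bihom_poisson_color_morphism_axioms.intro
          new algebra theta_linear theta_even)
      (simp_all add: theta_star theta_curly theta_alpha theta_beta)
  ultimately show ?thesis
    unfolding Let_def star_def curly_def by (rule conjI)
qed

end
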